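(* For each $n\ge 2$ let $j_n\in\{1,\dots,n-1\}$ be any index attaining the minimum in the definition of $\Delta_n$. Then, for every such choice of minimizing indices, as $n\to\infty$, $$n^2\Delta_n\to\frac{\pi^2}{4},\qquad n\ell_n\to\pi,\qquad \frac{x_{j_n,n}}n\to 2,\quad \frac{x_{j_n+1,n}}n\to2,$$ $$x_{j_n+1,n}-x_{j_n,n}\to 2\pi,\qquad \frac{j_n}{n}\to\frac12+\frac1\pi .$$
   Context: $L_n(t)=\sum_{j=0}^n(-1)^j\binom nj\frac{t^j}{j!}$ is the ordinary Laguerre polynomial, with zeros $0<x_{1,n}<\cdots<x_{n,n}$. For $n\ge2$, $\Delta_n=\min_{1\le j<n}\frac{(x_{j+1,n}-x_{j,n})^2}{4x_{j,n}x_{j+1,n}}$ and $\ell_n=\min_{1\le j<n}(\log x_{j+1,n}-\log x_{j,n})$. *)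

theory Defs
  imports "HOL-Analysis.Analysis" "HOL-Computational_Algebra.Polynomial"
begin

definition laguerre :: "nat \<Rightarrow> real poly" where
  "laguerre n = (\<Sum>j\<le>n. monom ((-1) ^ j * real (n choose j) / fact j) j)"

(* The j-th smallest real zero of laguerre n, with j counted from 1 as in x_{j,n}.
   All n zeros are real, positive and simple, so the list of distinct real zeros
   has length n; values for j = 0 or j > n are not meaningful. *)
definition laguerre_zero :: "nat \<Rightarrow> nat \<Rightarrow> real" where
  "laguerre_zero n j = sorted_list_of_set {t. poly (laguerre n) t = 0} ! (j - 1)"

definition rel_gap :: "nat \<Rightarrow> nat \<Rightarrow> real" where
  "rel_gap n j = (laguerre_zero n (j + 1) - laguerre_zero n j)\<^sup>2
     / (4 * laguerre_zero n j * laguerre_zero n (j + 1))"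

(* Both minima are meaningful for n >= 2 only; otherwise they range over the empty set. *)
definition min_rel_gap :: "nat \<Rightarrow> real" where
  "min_rel_gap n = (MIN j\<in>{1..<n}. rel_gap n j)"

definition min_log_gap :: "nat \<Rightarrow> real" where
  "min_log_gap n = (MIN j\<in>{1..<n}. ln (laguerre_zero n (j + 1)) - ln (laguerre_zero n j))"

end

theory Submission
  imports Defs
begin

text \<open>With \<open>N = n + 1/2\<close> and \<open>t = N exp s\<close> the function \<open>w(s) = e\<^sup>-\<^sup>t\<^sup>/\<^sup>2 L\<^sub>n(t)\<close> satisfies
  \<open>w'' = - N\<^sup>2 \<rho>(s) w\<close> with \<open>\<rho>(s) = exp s - (exp s)\<^sup>2 / 4 = 1 - (1 - exp s / 2)\<^sup>2 \<le> 1\<close>.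
  Sturm comparison with a sine shows that every logarithmic gap is at least \<open>\<pi> / N\<close>, nearly
  attained where \<open>\<rho>\<close> is close to 1, that is, near \<open>t = 2 N\<close>, and nowhere else. The relative gap
  is \<open>sinh\<^sup>2\<close> of half the logarithmic gap, so both minima have the same minimizers. Finally
  \<open>(N / \<pi>) \<integral> \<surd>\<rho>\<close> is asymptotically a lower bound for the number of zeros in an interval; as there
  are exactly \<open>n\<close> zeros, applying it on both sides of \<open>s = ln 2\<close> determines the limit of the
  index.\<close>

section \<open>Zeros of the Laguerre polynomials\<close>

lemma coeff_laguerre: "coeff (laguerre n) j = (-1) ^ j * real (n choose j) / fact j"
proof -
  have "coeff (laguerre n) j
      = (\<Sum>i\<le>n. if i = j then (-1) ^ i * real (n choose i) / fact i else 0)"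
    unfolding laguerre_def coeff_sum by (simp add: if_distrib cong: if_cong)
  also have "\<dots> = (-1) ^ j * real (n choose j) / fact j"
    by (auto simp: not_le binomial_eq_0)
  finally show ?thesis .
qed

lemma binomial_absorb_real:
  "(real j + 1) * real (n choose Suc j) = (real n - real j) * real (n choose j)"
proof (cases "j \<le> n")
  case True
  have "Suc j * (n choose Suc j) = (n - j) * (n choose j)"
    using binomial_absorb_comp[of n j] binomial_absorption[of j n] by simp
  then have "real (Suc j * (n choose Suc j)) = real ((n - j) * (n choose j))"
    by presburger
  with True show ?thesis by (simp add: of_nat_diff algebra_simps)
qed (simp add: binomial_eq_0)

text \<open>This is the Laguerre equation read off coefficientwise: one factor \<open>j + 1\<close>
  is absorbed by the binomial coefficient, the other by the factorial.\<close>

lemma coeff_laguerre_Suc: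
  "(real j + 1)\<^sup>2 * coeff (laguerre n) (Suc j) = (real j - real n) * coeff (laguerre n) j"
proof -
  have nz: "real j + 1 \<noteq> 0" "1 + real j \<noteq> 0" by linarith+
  have "(real j + 1)\<^sup>2 * coeff (laguerre n) (Suc j)
      = - ((-1) ^ j * ((real j + 1) * real (n choose Suc j)) / fact j)"
    using nz by (simp add: coeff_laguerre power2_eq_square) (simp add: divide_simps)
  also have "\<dots> = (real j - real n) * coeff (laguerre n) j"
    unfolding binomial_absorb_real by (simp add: coeff_laguerre field_simps)
  finally show ?thesis .
qed

text \<open>Multiplication by \<open>t\<close> is \<open>pCons 0\<close>, so this is
  \<open>t y'' + (1 - t) y' + n y = 0\<close>. Staying with polynomials lets
  \<open>coeff_laguerre_Suc\<close> settle each coefficient.\<close>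

lemma laguerre_ode_poly:
  "pCons 0 (pderiv (pderiv (laguerre n))) + (pderiv (laguerre n) - pCons 0 (pderiv (laguerre n)))
     + smult (real n) (laguerre n) = 0"
proof (rule poly_eqI)
  fix i
  show "coeff (pCons 0 (pderiv (pderiv (laguerre n)))
      + (pderiv (laguerre n) - pCons 0 (pderiv (laguerre n))) + smult (real n) (laguerre n)) i
      = coeff 0 i"
    using coeff_laguerre_Suc[of i n]
    by (cases i) (auto simp: coeff_pderiv algebra_simps power2_eq_square)
qed

lemma laguerre_ode:
  "t * poly (pderiv (pderiv (laguerre n))) t + (1 - t) * poly (pderiv (laguerre n)) t
     + real n * poly (laguerre n) t = 0"
  using arg_cong[OF laguerre_ode_poly, of "\<lambda>p. poly p t" n] by (simp add: algebra_simps)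

text \<open>Serves the induction on \<open>n\<close> that produces the zeros. After absorption, each
  coefficient comparison is Pascal's rule \<open>a + b\<close> for adjacent binomial
  coefficients.\<close>

lemma laguerre_Suc_poly:
  "smult (real n + 1) (laguerre (Suc n))
     = smult (real n + 1) (laguerre n) - pCons 0 (laguerre n) + pCons 0 (pderiv (laguerre n))"
proof (rule poly_eqI)
  fix i
  show "coeff (smult (real n + 1) (laguerre (Suc n))) i
      = coeff (smult (real n + 1) (laguerre n) - pCons 0 (laguerre n)
          + pCons 0 (pderiv (laguerre n))) i"
  proof (cases i)
    case 0
    then show ?thesis by (simp add: coeff_laguerre)
  next
    case (Suc k)
    have nz: "real k + 1 \<noteq> 0" "1 + real k \<noteq> 0" by linarith+
    define a b where "a = real (n choose k)" and "b = real (n choose Suc k)"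
    have rec: "(real k + 1) * b = (real n - real k) * a"
      unfolding a_def b_def by (rule binomial_absorb_real)
    have "coeff (smult (real n + 1) (laguerre n) - pCons 0 (laguerre n)
          + pCons 0 (pderiv (laguerre n))) i
        = - ((-1) ^ k * ((real n + 1) * b + (real k + 1) * a + (real k + 1) * b) / fact (Suc k))"
      unfolding Suc using nz
      by (simp add: coeff_laguerre coeff_pderiv flip: a_def b_def)
        (simp add: divide_simps, simp add: algebra_simps)
    also have "(real n + 1) * b + (real k + 1) * a + (real k + 1) * b = (real n + 1) * (a + b)"
      unfolding rec by (simp add: algebra_simps)
    finally show ?thesis
      unfolding Suc using nz
      by (simp add: coeff_laguerre flip: a_def b_def)
  qed
qed

lemma laguerre_Suc:
  "(real n + 1) * poly (laguerre (Suc n)) t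
     = (real n + 1 - t) * poly (laguerre n) t + t * poly (pderiv (laguerre n)) t"
  using arg_cong[OF laguerre_Suc_poly, of "\<lambda>p. poly p t" n] by (simp add: algebra_simps)

section \<open>Rolle arguments and the number of positive zeros\<close>

text \<open>Each pair of neighbours in \<open>Z\<close> contributes one critical point. The
  induction adds a new largest element \<open>b\<close>; keeping the critical points strictly
  between the extremes of \<open>Z\<close> makes the new one, above the old maximum, distinct from
  the others.\<close>

lemma Rolle_finite_set:
  fixes f f' :: "real \<Rightarrow> real"
  assumes deriv: "\<And>x. (f has_real_derivative f' x) (at x)"
    and "finite Z" "Z \<noteq> {}" "\<And>z. z \<in> Z \<Longrightarrow> f z = 0"
  shows "\<exists>W. finite W \<and> card W = card Z - 1 \<and> (\<forall>w\<in>W. f' w = 0 \<and> Min Z < w \<and> w < Max Z)"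
  using assms(2-)
proof (induction Z rule: finite_linorder_max_induct)
  case empty
  then show ?case by simp
next
  case (insert b A)
  show ?case
  proof (cases "A = {}")
    case True
    then show ?thesis by (intro exI[of _ "{}"]) simp
  next
    case False
    obtain W where W: "finite W" "card W = card A - 1"
      "\<And>w. w \<in> W \<Longrightarrow> f' w = 0 \<and> Min A < w \<and> w < Max A"
      using insert False by auto
    have MA: "Max A \<in> A" "Min A \<in> A" "Min A \<le> Max A"
      using insert(1) False by auto
    have "\<exists>w. Max A < w \<and> w < b \<and> f' w = 0"
    proof (rule Rolle[of "Max A" b f, THEN exE])
      show "Max A < b" using MA insert by blast
      show "f (Max A) = f b" using MA insert by simp
      show "continuous_on {Max A..b} f"
        using deriv by (meson DERIV_isCont continuous_at_imp_continuous_on)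
      show "\<And>x. f differentiable (at x)"
        using deriv real_differentiable_def by blast
    next
      fix z assume "Max A < z \<and> z < b \<and> DERIV f z :> 0"
      then show ?thesis using deriv DERIV_unique by blast
    qed
    then obtain w where w: "Max A < w" "w < b" "f' w = 0" by blast
    have bnd: "Min (insert b A) = Min A" "Max (insert b A) = b"
      using Min_insert[OF insert(1) False, of b] Max_insert[OF insert(1) False, of b]
        insert(2) MA(1,2) by (auto simp: min_def max_def not_le)
    have nin: "w \<notin> W" "b \<notin> A" using W(3) w(1) insert(2) by force+
    have "card A > 0" using insert(1) False by (simp add: card_gt_0_iff)
    then have "card (insert w W) = card (insert b A) - 1"
      using W nin insert(1) by simp
    moreover have "\<forall>v\<in>insert w W. f' v = 0 \<and> Min (insert b A) < v \<and> v < Max (insert b A)"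
      unfolding bnd using W(3) w MA insert(2) by fastforce
    ultimately show ?thesis using W(1) by blast
  qed
qed

text \<open>Infinity acts as a further zero of \<open>f\<close>. If \<open>f (a + 1)\<close> is
  positive, a maximum over a long interval is interior; a negative value is handled by
  \<open>- f\<close>, and the value zero by ordinary Rolle.\<close>

lemma Rolle_at_top:
  fixes f f' :: "real \<Rightarrow> real"
  assumes deriv: "\<And>x. (f has_real_derivative f' x) (at x)"
    and "f a = 0" "(f \<longlongrightarrow> 0) at_top"
  shows "\<exists>w>a. f' w = 0"
proof -
  have pos: "\<exists>w>a. g' w = 0"
    if g: "\<And>x. (g has_real_derivative g' x) (at x)" "g a = 0" "(g \<longlongrightarrow> 0) at_top" "g (a + 1) > 0"
    for g g' :: "real \<Rightarrow> real"
  proof -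
    \<comment> \<open>Far enough out \<open>g\<close> has dropped below \<open>g (a + 1)\<close>, so
      for such an endpoint \<open>b\<close> the maximum over \<open>{a..b}\<close> is attained at
      neither end.\<close>
    have "eventually (\<lambda>x. g x < g (a + 1)) at_top"
      using g(3,4) by (rule order_tendstoD(2))
    then have "eventually (\<lambda>x. g x < g (a + 1) \<and> x > a + 1) at_top"
      using eventually_gt_at_top by (rule eventually_conj)
    then obtain b where b: "g b < g (a + 1)" "b > a + 1"
      using eventually_happens'[OF trivial_limit_at_top_linorder] by blast
    have "continuous_on {a..b} g"
      using g(1) by (meson DERIV_isCont continuous_at_imp_continuous_on)
    then obtain m where m: "m \<in> {a..b}" "\<And>y. y \<in> {a..b} \<Longrightarrow> g y \<le> g m"
      using continuous_attains_sup[of "{a..b}" g] b by auto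
    have "g (a + 1) \<le> g m" using m(2) b by simp
    then have "m \<noteq> a" "m \<noteq> b" using g(2,4) b by auto
    then have ab: "a < m" "m < b" using m(1) by auto
    have "g' m = 0"
    proof (rule DERIV_local_max[OF g(1)])
      show "0 < min (m - a) (b - m)" using ab by simp
      show "\<forall>y. \<bar>m - y\<bar> < min (m - a) (b - m) \<longrightarrow> g y \<le> g m"
        using m(2) by (auto simp: abs_if split: if_splits)
    qed
    with ab show ?thesis by blast
  qed
  consider "f (a + 1) > 0" | "f (a + 1) < 0" | "f (a + 1) = 0" by linarith
  then show ?thesis
  proof cases
    case 1
    then show ?thesis by (rule pos[OF deriv assms(2,3)])
  next
    case 2
    have "((\<lambda>x. - f x) \<longlongrightarrow> 0) at_top"
      using tendsto_minus[OF assms(3)] by simp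
    then have "\<exists>w>a. - f' w = 0"
      using 2 assms(2) by (intro pos[of "\<lambda>x. - f x"] DERIV_minus deriv) simp_all
    then show ?thesis by simp
  next
    case 3
    have "\<exists>z. a < z \<and> z < a + 1 \<and> DERIV f z :> 0"
    proof (rule Rolle)
      show "continuous_on {a..a + 1} f"
        using deriv by (meson DERIV_isCont continuous_at_imp_continuous_on)
      show "\<And>x. f differentiable (at x)"
        using deriv real_differentiable_def by blast
    qed (use 3 assms(2) in simp_all)
    then obtain z where z: "a < z" "DERIV f z :> 0" by blast
    then show ?thesis using DERIV_unique[OF deriv z(2)] by blast
  qed
qed

lemma poly_times_exp_minus_tendsto_0:
  fixes p :: "real poly"
  shows "((\<lambda>x. poly p x * exp (- x)) \<longlongrightarrow> 0) at_top"
proof -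
  have "((\<lambda>x. \<Sum>i\<le>degree p. coeff p i * (x ^ i / exp x)) \<longlongrightarrow> (\<Sum>i\<le>degree p. coeff p i * 0)) at_top"
    by (intro tendsto_sum tendsto_mult tendsto_const tendsto_power_div_exp_0)
  then show ?thesis
    by (simp add: poly_altdef exp_minus sum_distrib_right divide_inverse mult.assoc)
qed

text \<open>Rolle's theorem on \<open>[0, \<infinity>)\<close> for \<open>t\<^sup>n\<^sup>+\<^sup>1 e\<^sup>-\<^sup>t L\<^sub>n(t)\<close>, whose derivative is
  \<open>(n + 1) t\<^sup>n e\<^sup>-\<^sup>t L\<^sub>n\<^sub>+\<^sub>1(t)\<close>.\<close>
lemma laguerre_positive_zeros:
  "\<exists>W. finite W \<and> card W = n \<and> (\<forall>w\<in>W. 0 < w \<and> poly (laguerre n) w = 0)"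
proof (induction n)
  case 0
  show ?case by (intro exI[of _ "{}"]) simp
next
  case (Suc n)
  then obtain W where W: "finite W" "card W = n" "\<And>w. w \<in> W \<Longrightarrow> 0 < w \<and> poly (laguerre n) w = 0"
    by blast
  define f where "f t = poly (monom 1 (Suc n) * laguerre n) t * exp (- t)" for t :: real
  define f' where "f' t = (real n + 1) * t ^ n * exp (- t) * poly (laguerre (Suc n)) t" for t
  \<comment> \<open>The monomial factor makes 0 a zero of \<open>f\<close> besides the
    \<open>n\<close> zeros in \<open>W\<close>. These \<open>n + 1\<close> zeros give
    \<open>n\<close> critical points below \<open>Max Z\<close>, and decay at infinity gives one
    more above it.\<close>
  define Z where "Z = insert 0 W"
  have deriv: "(f has_real_derivative f' t) (at t)" for t
  proof -
    have "f' t = t ^ n * exp (- t) * ((real n + 1) * poly (laguerre (Suc n)) t)"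
      by (simp add: f'_def)
    also have "\<dots> = t ^ n * exp (- t) * ((real n + 1 - t) * poly (laguerre n) t
        + t * poly (pderiv (laguerre n)) t)"
      unfolding laguerre_Suc ..
    finally show ?thesis
      unfolding f_def poly_mult poly_monom
      by (auto intro!: derivative_eq_intros poly_DERIV simp: algebra_simps simp del: power_Suc)
        (simp add: algebra_simps)
  qed
  have Z: "finite Z" "Z \<noteq> {}" "card Z = Suc n" "Min Z = 0"
  proof -
    have "0 \<notin> W" using W(3) by blast
    then show "card Z = Suc n" using W by (simp add: Z_def)
    show "Min Z = 0" using W by (intro Min_eqI) (auto simp: Z_def intro: less_imp_le)
  qed (use W in \<open>auto simp: Z_def\<close>)
  have fZ: "f z = 0" if "z \<in> Z" for z
    using that W(3) by (auto simp: f_def Z_def poly_monom)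
  obtain V where V: "finite V" "card V = n"
    "\<And>v. v \<in> V \<Longrightarrow> f' v = 0 \<and> 0 < v \<and> v < Max Z"
    using Rolle_finite_set[OF deriv Z(1,2) fZ] Z(3,4) by auto
  have "(f \<longlongrightarrow> 0) at_top"
    unfolding f_def by (rule poly_times_exp_minus_tendsto_0)
  then obtain v where v: "v > Max Z" "f' v = 0"
    using Rolle_at_top[OF deriv fZ[OF Max_in[OF Z(1,2)]]] by blast
  have "0 \<le> Max Z" using Z by (metis Min_le Max_in)
  then have "v > 0" using v by simp
  have "v \<notin> V" using V(3) v by force
  then have "card (insert v V) = Suc n" using V by simp
  moreover have "\<forall>u\<in>insert v V. 0 < u \<and> poly (laguerre (Suc n)) u = 0"
    using V(3) v \<open>v > 0\<close> by (auto simp: f'_def)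
  ultimately show ?case using V(1) by blast
qed

text \<open>The degree is at most \<open>n\<close>, so the \<open>n\<close> positive zeros already
  found exhaust all real zeros.\<close>

lemma laguerre_zeros:
  shows finite_laguerre_zeros: "finite {t. poly (laguerre n) t = 0}"
    and card_laguerre_zeros: "card {t. poly (laguerre n) t = 0} = n"
    and laguerre_zeros_pos: "poly (laguerre n) t = 0 \<Longrightarrow> 0 < t"
proof -
  have nz: "laguerre n \<noteq> 0"
    using coeff_laguerre[of n 0] by auto
  show fin: "finite {t. poly (laguerre n) t = 0}"
    using nz by (rule poly_roots_finite)
  have "degree (laguerre n) \<le> n"
    by (rule degree_le) (simp add: coeff_laguerre)
  then have le: "card {t. poly (laguerre n) t = 0} \<le> n"
    using card_poly_roots_bound[OF nz] by linarith
  obtain W where W: "finite W" "card W = n" "\<And>w. w \<in> W \<Longrightarrow> 0 < w \<and> poly (laguerre n) w = 0"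
    using laguerre_positive_zeros by blast
  have eq: "W = {t. poly (laguerre n) t = 0}"
    using W le fin by (intro card_seteq) auto
  show "card {t. poly (laguerre n) t = 0} = n" using W(2) unfolding eq .
  show "0 < t" if "poly (laguerre n) t = 0"
    using W(3)[of t] that unfolding eq by simp
qed

lemma strict_mono_on_laguerre_zero: "strict_mono_on {1..n} (laguerre_zero n)"
proof (rule strict_mono_onI)
  fix i k assume "i \<in> {1..n}" "k \<in> {1..n}" "i < k"
  moreover have "length (sorted_list_of_set {t. poly (laguerre n) t = 0}) = n"
    by (simp add: card_laguerre_zeros)
  ultimately show "laguerre_zero n i < laguerre_zero n k"
    unfolding laguerre_zero_def
    by (intro sorted_wrt_nth_less[OF strict_sorted_list_of_set]) auto
qed

lemma laguerre_zero_image: "laguerre_zero n ` {1..n} = {t. poly (laguerre n) t = 0}"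
proof -
  define xs where "xs = sorted_list_of_set {t. poly (laguerre n) t = 0}"
  have len: "length xs = n" by (simp add: xs_def card_laguerre_zeros)
  have "set xs = (\<lambda>i. xs ! i) ` {..<n}" using len by (auto simp: set_conv_nth)
  also have "{..<n} = (\<lambda>j. j - 1) ` {1..n}"
    by (auto simp: image_iff intro!: bexI[of _ "Suc _"])
  also have "(\<lambda>i. xs ! i) ` (\<lambda>j. j - 1) ` {1..n} = laguerre_zero n ` {1..n}"
    by (auto simp: laguerre_zero_def xs_def image_iff)
  finally show ?thesis using finite_laguerre_zeros by (simp add: xs_def)
qed

section \<open>Sturm comparison\<close>

text \<open>The Wronskian of \<open>w\<close> with a solution of \<open>S'' = - q^2 S\<close>. Both
  Sturm lemmas take \<open>q = pi / (b - a)\<close>, for which the sine vanishes at \<open>a\<close>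
  and \<open>b\<close> and is positive between them.\<close>

lemma wronskian_sine_deriv:
  fixes w w' Q :: "real \<Rightarrow> real"
  assumes "\<And>x. (w has_real_derivative w' x) (at x)"
    and "\<And>x. (w' has_real_derivative - Q x * w x) (at x)"
  shows "((\<lambda>x. w' x * sin (q * (x - a)) - w x * (q * cos (q * (x - a))))
    has_real_derivative (q\<^sup>2 - Q x) * w x * sin (q * (x - a))) (at x)"
  by (auto intro!: derivative_eq_intros assms simp: algebra_simps power2_eq_square)

lemma sin_scaled_pos:
  assumes "a < x" "x < (b::real)"
  shows "0 < sin (pi / (b - a) * (x - a))"
proof (rule sin_gt_zero)
  show "0 < pi / (b - a) * (x - a)" using assms by simp
  have "pi * (x - a) < pi * (b - a)" using assms by simp
  then show "pi / (b - a) * (x - a) < pi" using assms by (simp add: field_simps)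
qed

text \<open>The Wronskian with the sine vanishes at both ends, so Rolle gives an interior zero of
  its derivative, where neither \<open>w\<close> nor the sine can vanish. An exact value of
  \<open>Q\<close>, rather than an inequality, serves both to bound a gap and to locate it.\<close>

lemma sturm_adjacent_zeros:
  fixes w w' Q :: "real \<Rightarrow> real"
  assumes deriv: "\<And>x. (w has_real_derivative w' x) (at x)"
    "\<And>x. (w' has_real_derivative - Q x * w x) (at x)"
    and "a < b" "w a = 0" "w b = 0" and nz: "\<And>x. a < x \<Longrightarrow> x < b \<Longrightarrow> w x \<noteq> 0"
  obtains x where "a < x" "x < b" "Q x = (pi / (b - a))\<^sup>2"
proof -
  define q where "q = pi / (b - a)"
  define W where "W x = w' x * sin (q * (x - a)) - w x * (q * cos (q * (x - a)))" for x
  have W': "(W has_real_derivative (q\<^sup>2 - Q x) * w x * sin (q * (x - a))) (at x)" for x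
    unfolding W_def by (rule wronskian_sine_deriv[OF deriv])
  have "q * (b - a) = pi" using \<open>a < b\<close> by (simp add: q_def)
  then have "W a = W b" using assms by (simp add: W_def)
  moreover have "continuous_on {a..b} W"
    using W' by (meson DERIV_isCont continuous_at_imp_continuous_on)
  moreover have "\<And>x. W differentiable (at x)" using W' real_differentiable_def by blast
  ultimately obtain x where x: "a < x" "x < b" "(W has_real_derivative 0) (at x)"
    using Rolle[of a b W] \<open>a < b\<close> by blast
  then have "(q\<^sup>2 - Q x) * w x * sin (q * (x - a)) = 0"
    using DERIV_unique W' by blast
  moreover have "sin (q * (x - a)) > 0"
    unfolding q_def by (rule sin_scaled_pos[OF x(1,2)])
  ultimately have "Q x = q\<^sup>2" using nz[OF x(1,2)] by simp
  with x that show thesis unfolding q_def by blast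
qed

text \<open>A solution without zeros inside may be taken positive. Its Wronskian with the sine would
  then strictly decrease, against its values at the two ends.\<close>

lemma sturm_zero_between:
  fixes w w' Q :: "real \<Rightarrow> real"
  assumes deriv: "\<And>x. (w has_real_derivative w' x) (at x)"
    "\<And>x. (w' has_real_derivative - Q x * w x) (at x)"
    and "a < b" and Q: "\<And>x. a < x \<Longrightarrow> x < b \<Longrightarrow> (pi / (b - a))\<^sup>2 < Q x"
  shows "\<exists>x. a < x \<and> x < b \<and> w x = 0"
proof (rule ccontr)
  assume "\<not> ?thesis"
  then have nz: "\<And>x. a < x \<Longrightarrow> x < b \<Longrightarrow> w x \<noteq> 0" by blast
  have contra: False
    if d: "\<And>x. (u has_real_derivative u' x) (at x)"
      "\<And>x. (u' has_real_derivative - Q x * u x) (at x)"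
      and pos: "\<And>x. a < x \<Longrightarrow> x < b \<Longrightarrow> 0 < u x"
    for u u' :: "real \<Rightarrow> real"
  proof -
    define q where "q = pi / (b - a)"
    define W where "W x = u' x * sin (q * (x - a)) - u x * (q * cos (q * (x - a)))" for x
    have W': "(W has_real_derivative (q\<^sup>2 - Q x) * u x * sin (q * (x - a))) (at x)" for x
      unfolding W_def by (rule wronskian_sine_deriv[OF d])
    have cont: "continuous_on {a..b} u"
      using d(1) by (meson DERIV_isCont continuous_at_imp_continuous_on)
    \<comment> \<open>Positivity is given only inside; continuity makes the end values nonnegative.
      Hence \<open>W b - W a = q * (u a + u b)\<close> is nonnegative, whereas the mean value
      theorem makes it negative.\<close>
    have "u x \<ge> 0" if "x \<in> {a..b}" for x
    proof (rule continuous_ge_on_closure[of "{a<..<b}" u x 0])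
      show "continuous_on (closure {a<..<b}) u" "x \<in> closure {a<..<b}"
        using cont that \<open>a < b\<close> by auto
      show "\<And>x. x \<in> {a<..<b} \<Longrightarrow> 0 \<le> u x" using pos by (simp add: less_imp_le)
    qed
    then have ends: "0 \<le> u a" "0 \<le> u b" using \<open>a < b\<close> by auto
    have "q > 0" "q * (b - a) = pi" using \<open>a < b\<close> by (simp_all add: q_def)
    then have "W a = - (u a * q)" "W b = u b * q" by (simp_all add: W_def)
    moreover have "0 \<le> u a * q" "0 \<le> u b * q" using ends \<open>q > 0\<close> by simp_all
    ultimately have "W a \<le> W b" by linarith
    moreover obtain x where x: "a < x" "x < b"
      "W b - W a = (b - a) * ((q\<^sup>2 - Q x) * u x * sin (q * (x - a)))"
      using MVT2[OF \<open>a < b\<close> W'] by blast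
    moreover have "(q\<^sup>2 - Q x) * (u x * sin (q * (x - a))) < 0"
    proof (rule mult_neg_pos)
      show "q\<^sup>2 - Q x < 0" using Q[OF x(1,2)] by (simp add: q_def)
      show "0 < u x * sin (q * (x - a))"
        unfolding q_def using pos[OF x(1,2)] sin_scaled_pos[OF x(1,2)] by simp
    qed
    ultimately show False
      using \<open>a < b\<close> mult_pos_neg[of "b - a" "(q\<^sup>2 - Q x) * (u x * sin (q * (x - a)))"]
      by (simp add: mult.assoc)
  qed
  \<comment> \<open>By connectedness \<open>w\<close> keeps the sign it has at the midpoint. If that
    sign is negative, \<open>contra\<close> applies to \<open>- w\<close>, which solves the same
    equation.\<close>
  define m where "m = (a + b) / 2"
  have m: "a < m" "m < b" using \<open>a < b\<close> by (simp_all add: m_def)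
  have same_sign: "w x * w m > 0" if x: "a < x" "x < b" for x
  proof (rule ccontr)
    assume "\<not> w x * w m > 0"
    then have "w x \<le> 0 \<and> 0 \<le> w m \<or> w m \<le> 0 \<and> 0 \<le> w x"
      by (auto simp: zero_less_mult_iff not_less)
    moreover have "connected (w ` {a<..<b})"
      using deriv(1) by (intro connected_continuous_image continuous_at_imp_continuous_on)
        (auto intro: DERIV_isCont)
    moreover have "w x \<in> w ` {a<..<b}" "w m \<in> w ` {a<..<b}" using x m by auto
    ultimately have "0 \<in> w ` {a<..<b}"
      using connectedD_interval[of "w ` {a<..<b}" _ _ 0] by blast
    then show False using nz by force
  qed
  consider "w m > 0" | "w m < 0" using nz[OF m] by linarith
  then show False
  proof cases
    case 1
    then show False
      using contra[OF deriv] same_sign by (simp add: zero_less_mult_iff)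
  next
    case 2
    have "((\<lambda>x. - w' x) has_real_derivative - Q x * - w x) (at x)" for x
      using DERIV_minus[OF deriv(2)] by simp
    from contra[OF DERIV_minus[OF deriv(1)] this] show False
      using 2 same_sign by (auto simp: zero_less_mult_iff)
  qed
qed

section \<open>The Laguerre equation in the logarithmic variable\<close>

text \<open>The function \<rho> of the overview: for \<open>t = N * exp s\<close>,
  \<open>N^2 * potential s = t * (N - t / 4)\<close>.\<close>

definition potential :: "real \<Rightarrow> real" where
  "potential s = exp s - (exp s)\<^sup>2 / 4"

definition laguerre_log :: "nat \<Rightarrow> real \<Rightarrow> real" where
  "laguerre_log n s = exp (- ((real n + 1/2) * exp s / 2)) * poly (laguerre n) ((real n + 1/2) * exp s)"

definition laguerre_log' :: "nat \<Rightarrow> real \<Rightarrow> real" where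
  "laguerre_log' n s = exp (- ((real n + 1/2) * exp s / 2)) * ((real n + 1/2) * exp s)
     * (poly (pderiv (laguerre n)) ((real n + 1/2) * exp s)
        - poly (laguerre n) ((real n + 1/2) * exp s) / 2)"

context
  fixes T :: "real \<Rightarrow> real"
  assumes T: "\<And>s. (T has_real_derivative T s) (at s)"
begin

private lemma deriv_poly: "((\<lambda>s. poly p (T s)) has_real_derivative poly (pderiv p) (T s) * T s) (at s)"
  by (rule DERIV_chain2[OF poly_DERIV T])

private lemma deriv_weight:
  "((\<lambda>s. exp (- (T s / 2))) has_real_derivative - (T s / 2) * exp (- (T s / 2))) (at s)"
  by (rule derivative_eq_intros T refl | simp)+

text \<open>\<open>T\<close> stands for \<open>N * exp s\<close>. Only \<open>T' = T\<close> enters,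
  so both derivatives remain expressions in \<open>T s\<close>.\<close>

lemma weighted_poly_deriv:
  "((\<lambda>s. exp (- (T s / 2)) * poly p (T s)) has_real_derivative
     exp (- (T s / 2)) * T s * (poly (pderiv p) (T s) - poly p (T s) / 2)) (at s)"
  using DERIV_mult[OF deriv_weight[of s] deriv_poly[of p s]] by (simp add: algebra_simps)

lemma weighted_poly_deriv2:
  "((\<lambda>s. exp (- (T s / 2)) * T s * (poly (pderiv p) (T s) - poly p (T s) / 2)) has_real_derivative
     exp (- (T s / 2)) * (T s * ((poly (pderiv p) (T s) - poly p (T s) / 2) * (1 - T s / 2)
       + T s * (poly (pderiv (pderiv p)) (T s) - poly (pderiv p) (T s) / 2)))) (at s)"
proof -
  have "((\<lambda>s. poly (pderiv p) (T s) - poly p (T s) / 2) has_real_derivative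
      poly (pderiv (pderiv p)) (T s) * T s - poly (pderiv p) (T s) * T s / 2) (at s)"
    by (intro DERIV_diff DERIV_cdivide deriv_poly)
  from DERIV_mult[OF DERIV_mult[OF deriv_weight T] this] show ?thesis
    by (rule DERIV_cong) (simp add: field_simps)
qed

end

lemma exp_scaled_deriv: "((\<lambda>s. N * exp s) has_real_derivative N * exp s) (at s)" for N :: real
  by (rule DERIV_cmult[OF DERIV_exp])

lemma laguerre_log_deriv: "(laguerre_log n has_real_derivative laguerre_log' n s) (at s)"
  unfolding laguerre_log_def[abs_def] laguerre_log'_def
  by (rule weighted_poly_deriv[OF exp_scaled_deriv])

lemma laguerre_log_deriv2:
  "(laguerre_log' n has_real_derivative
     - ((real n + 1/2)\<^sup>2 * potential s) * laguerre_log n s) (at s)"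
proof -
  define N t where "N = real n + 1/2" and "t = N * exp s"
  define y y1 y2 where "y = poly (laguerre n) t" and "y1 = poly (pderiv (laguerre n)) t"
    and "y2 = poly (pderiv (pderiv (laguerre n))) t"
  have "(laguerre_log' n has_real_derivative
      exp (- (t / 2)) * (t * ((y1 - y / 2) * (1 - t / 2) + t * (y2 - y1 / 2)))) (at s)"
    unfolding laguerre_log'_def[abs_def] y_def y1_def y2_def t_def N_def
    by (rule weighted_poly_deriv2[OF exp_scaled_deriv])
  \<comment> \<open>The Laguerre operator is split off and vanishes. The remainder has no
    \<open>y1\<close> term, and the weight \<open>exp (- t / 2)\<close> is what turns
    \<open>n\<close> into \<open>N = n + 1/2\<close>.\<close>
  also have "(y1 - y / 2) * (1 - t / 2) + t * (y2 - y1 / 2)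
      = (t * y2 + (1 - t) * y1 + real n * y) - (N - t / 4) * y"
    by (simp add: N_def algebra_simps)
  also have "t * y2 + (1 - t) * y1 + real n * y = 0"
    unfolding y_def y1_def y2_def by (rule laguerre_ode)
  also have "exp (- (t / 2)) * (t * (0 - (N - t / 4) * y)) = - (N\<^sup>2 * potential s) * laguerre_log n s"
  proof -
    have "N\<^sup>2 * potential s = t * (N - t / 4)"
      by (simp add: t_def potential_def power2_eq_square algebra_simps)
    moreover have "laguerre_log n s = exp (- (t / 2)) * y"
      by (simp add: laguerre_log_def y_def t_def N_def)
    ultimately show ?thesis by simp
  qed
  finally show ?thesis unfolding N_def .
qed

lemma laguerre_log_eq_0_iff:
  "laguerre_log n s = 0 \<longleftrightarrow> poly (laguerre n) ((real n + 1/2) * exp s) = 0"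
  by (simp add: laguerre_log_def)

lemma potential_eq: "potential s = 1 - (1 - exp s / 2)\<^sup>2"
  by (simp add: potential_def power2_eq_square algebra_simps)

lemma potential_le_1: "potential s \<le> 1"
  by (simp add: potential_eq)

lemma continuous_on_potential [continuous_intros]: "continuous_on A potential"
  unfolding potential_def[abs_def] by (intro continuous_intros) simp

section \<open>The zeros on the logarithmic scale\<close>

text \<open>Dividing by \<open>N\<close> places the zero in the variable \<open>s\<close>, where the
  potential does not depend on \<open>n\<close>; logarithmic gaps are unaffected by the
  scaling.\<close>

definition log_zero :: "nat \<Rightarrow> nat \<Rightarrow> real" where
  "log_zero n j = ln (laguerre_zero n j / (real n + 1/2))"

lemma laguerre_zero_pos: "j \<in> {1..n} \<Longrightarrow> 0 < laguerre_zero n j"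
  using laguerre_zero_image[of n] laguerre_zeros_pos[of n] by blast

lemma laguerre_zero_eq_exp:
  "j \<in> {1..n} \<Longrightarrow> laguerre_zero n j = (real n + 1/2) * exp (log_zero n j)"
  using laguerre_zero_pos[of j n] by (simp add: log_zero_def)

lemma strict_mono_on_log_zero: "strict_mono_on {1..n} (log_zero n)"
proof (rule strict_mono_onI)
  fix i k assume *: "i \<in> {1..n}" "k \<in> {1..n}" "i < k"
  then have "laguerre_zero n i < laguerre_zero n k"
    using strict_mono_on_laguerre_zero by (simp add: strict_mono_on_def)
  with * laguerre_zero_pos[of i n] show "log_zero n i < log_zero n k"
    unfolding log_zero_def by (simp add: divide_strict_right_mono)
qed

lemma log_zero_image: "log_zero n ` {1..n} = {s. laguerre_log n s = 0}"
proof (intro equalityI subsetI)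
  fix s assume "s \<in> log_zero n ` {1..n}"
  then obtain j where j: "j \<in> {1..n}" "s = log_zero n j" by blast
  have "laguerre_zero n j \<in> {t. poly (laguerre n) t = 0}"
    using j(1) unfolding laguerre_zero_image[symmetric] by blast
  then show "s \<in> {s. laguerre_log n s = 0}"
    using laguerre_zero_eq_exp[OF j(1)] j(2) by (simp add: laguerre_log_eq_0_iff)
next
  fix s assume "s \<in> {s. laguerre_log n s = 0}"
  then have "(real n + 1/2) * exp s \<in> laguerre_zero n ` {1..n}"
    unfolding laguerre_zero_image by (simp add: laguerre_log_eq_0_iff)
  then obtain j where j: "j \<in> {1..n}" "laguerre_zero n j = (real n + 1/2) * exp s"
    by force
  then have "log_zero n j = s" by (simp add: log_zero_def)
  with j show "s \<in> log_zero n ` {1..n}" by blast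
qed

lemma log_gap_eq:
  assumes "j \<in> {1..<n}"
  shows "ln (laguerre_zero n (j + 1)) - ln (laguerre_zero n j) = log_zero n (Suc j) - log_zero n j"
proof -
  have "j \<in> {1..n}" "Suc j \<in> {1..n}" using assms by auto
  then show ?thesis
    using laguerre_zero_pos[of j n] laguerre_zero_pos[of "Suc j" n]
    unfolding log_zero_def by (subst (1 2) ln_div) auto
qed

text \<open>Monotonicity in the index excludes further zeros between neighbours, so Sturm applies.
  Since the potential is at most 1, the gap is at least \<open>pi / N\<close>; the value at
  \<open>x\<close> also tells where a gap near this bound must lie.\<close>

lemma adjacent_log_zeros:
  assumes "j \<in> {1..<n}"
  obtains x where "log_zero n j < x" "x < log_zero n (Suc j)"
    "(real n + 1/2)\<^sup>2 * potential x = (pi / (log_zero n (Suc j) - log_zero n j))\<^sup>2"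
proof -
  have j: "j \<in> {1..n}" "Suc j \<in> {1..n}" using assms by auto
  have lt: "log_zero n j < log_zero n (Suc j)"
    using strict_mono_on_log_zero j by (simp add: strict_mono_on_def)
  have zero: "laguerre_log n (log_zero n i) = 0" if "i \<in> {1..n}" for i
    using imageI[OF that, of "log_zero n"] unfolding log_zero_image by simp
  have nz: "laguerre_log n x \<noteq> 0" if "log_zero n j < x" "x < log_zero n (Suc j)" for x
  proof
    assume "laguerre_log n x = 0"
    then have "x \<in> log_zero n ` {1..n}" unfolding log_zero_image by simp
    then obtain i where i: "i \<in> {1..n}" "x = log_zero n i" by blast
    have "j < i" "i < Suc j"
      using that j i strict_mono_on_less[OF strict_mono_on_log_zero] by simp_all
    then show False by simp
  qed
  show thesis
    by (rule sturm_adjacent_zeros[OF laguerre_log_deriv laguerre_log_deriv2 lt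
          zero[OF j(1)] zero[OF j(2)]])
      (use nz that in auto)
qed

lemma log_zero_between:
  assumes "a < b"
    and "\<And>x. a < x \<Longrightarrow> x < b \<Longrightarrow> (pi / (b - a))\<^sup>2 < (real n + 1/2)\<^sup>2 * potential x"
  obtains j where "j \<in> {1..n}" "a < log_zero n j" "log_zero n j < b"
proof -
  have "\<exists>x. a < x \<and> x < b \<and> laguerre_log n x = 0"
    by (rule sturm_zero_between[OF laguerre_log_deriv laguerre_log_deriv2 assms(1)]) (rule assms(2))
  then obtain x where x: "a < x" "x < b" "x \<in> log_zero n ` {1..n}"
    unfolding log_zero_image by blast
  from x(3) obtain j where "j \<in> {1..n}" "x = log_zero n j" by blast
  with x that show thesis by simp
qed

section \<open>Counting zeros\<close>

text \<open>Works leftwards from \<open>B\<close>: the intermediate value theorem gives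
  \<open>b\<close> where \<phi> is smaller by \<open>c\<close>, the piece from \<open>b\<close> to
  \<open>B\<close> contributes one point, and induction handles \<open>{A..b}\<close>. The pieces
  are disjoint, so the points differ.\<close>

lemma card_ge_of_increments:
  fixes \<phi> :: "real \<Rightarrow> real"
  assumes "finite Z" and "0 < c"
    and hit: "\<And>a b. A \<le> a \<Longrightarrow> a < b \<Longrightarrow> b \<le> B \<Longrightarrow> \<phi> b - \<phi> a = c \<Longrightarrow> \<exists>z\<in>Z. a < z \<and> z < b"
    and "A \<le> B" "continuous_on {A..B} \<phi>" "real m * c \<le> \<phi> B - \<phi> A"
  shows "m \<le> card (Z \<inter> {A<..<B})"
  using assms(3-)
proof (induction m arbitrary: B)
  case 0
  show ?case by simp
next
  case (Suc m)
  have step: "real m * c + c \<le> \<phi> B - \<phi> A" using Suc.prems(4) by (simp add: algebra_simps)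
  moreover have "0 \<le> real m * c" using \<open>0 < c\<close> by simp
  ultimately have "\<phi> A \<le> \<phi> B - c" "\<phi> B - c \<le> \<phi> B" using \<open>0 < c\<close> by linarith+
  then obtain b where b: "A \<le> b" "b \<le> B" "\<phi> b = \<phi> B - c"
    using IVT'[of \<phi> A "\<phi> B - c" B] Suc.prems(2,3) by blast
  then have "b \<noteq> B" using \<open>0 < c\<close> by auto
  with b have "b < B" by simp
  have "m \<le> card (Z \<inter> {A<..<b})"
  proof (rule Suc.IH)
    show "continuous_on {A..b} \<phi>"
      using continuous_on_subset[OF Suc.prems(3)] b by simp
  qed (use Suc.prems(1) b step in auto)
  moreover obtain z where z: "z \<in> Z" "b < z" "z < B"
    using Suc.prems(1)[of b B] b \<open>b < B\<close> by auto
  then have "card (insert z (Z \<inter> {A<..<b})) = Suc (card (Z \<inter> {A<..<b}))"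
    using \<open>finite Z\<close> by simp
  moreover have "card (insert z (Z \<inter> {A<..<b})) \<le> card (Z \<inter> {A<..<B})"
    using z b \<open>finite Z\<close> by (intro card_mono) auto
  ultimately show ?case by simp
qed

text \<open>With \<open>exp s = 4 sin\<^sup>2 \<theta>\<close> this is \<open>2 \<theta> + sin (2 \<theta>)\<close>.\<close>
definition phase :: "real \<Rightarrow> real" where
  "phase s = 2 * arcsin (exp (s / 2) / 2) + sqrt (potential s)"

section \<open>Derivative and boundary values of the phase\<close>

lemma exp_half_eq_sqrt: "exp (s / 2) = sqrt (exp s)" for s :: real
  by (rule real_sqrt_unique[symmetric]) (simp_all add: exp_double[symmetric])

lemma exp_half_less_2: "s < ln 4 \<Longrightarrow> exp (s / 2) < (2::real)"
proof -
  assume "s < ln 4"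
  then have "exp s < 4" by (metis exp_less_cancel_iff exp_ln zero_less_numeral)
  then have "(exp (s / 2))\<^sup>2 < 2\<^sup>2" by (simp add: exp_double[symmetric])
  then show ?thesis by (rule power2_less_imp_less) simp
qed

lemma potential_pos: "s < ln 4 \<Longrightarrow> 0 < potential s"
proof -
  assume "s < ln 4"
  then have "exp s < 4" by (metis exp_less_cancel_iff exp_ln zero_less_numeral)
  then have "0 < exp s * (1 - exp s / 4)" by simp
  then show ?thesis by (simp add: potential_def power2_eq_square algebra_simps)
qed

text \<open>This makes increments of \<open>phase\<close> the integrals of the square root of the
  potential. In the substitution by \<theta>, \<open>e = 2 sin \<theta>\<close> and
  \<open>c = cos \<theta>\<close>, so the derivative is
  \<open>e * c = sin (2 \<theta>)\<close>.\<close>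

lemma phase_deriv:
  assumes "s < ln 4"
  shows "(phase has_real_derivative sqrt (potential s)) (at s)"
proof -
  define e c where "e = exp (s / 2)" and "c = sqrt (1 - (e / 2)\<^sup>2)"
  have e: "0 < e" "e < 2" using exp_half_less_2[OF assms] by (simp_all add: e_def)
  have exp_s: "exp s = e\<^sup>2" by (simp add: e_def exp_double[symmetric])
  have "(e / 2)\<^sup>2 < 1" using e by (simp add: power_less_one_iff abs_square_less_1)
  then have c: "0 < c" "c\<^sup>2 = 1 - e\<^sup>2 / 4" by (simp_all add: c_def power_divide)
  have pot: "potential s = (e * c)\<^sup>2"
    unfolding power_mult_distrib c(2) by (simp add: potential_def exp_s algebra_simps power2_eq_square)
  have sq: "sqrt (potential s) = e * c" unfolding pot using e c by simp
  have "((\<lambda>s. arcsin (exp (s / 2) / 2)) has_real_derivative inverse c * (e / 4)) (at s)"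
    unfolding c_def e_def
    by (rule DERIV_chain2[OF DERIV_arcsin]) (use e in \<open>auto intro!: derivative_eq_intros simp: e_def intro: less_trans[of _ 0]\<close>)
  moreover have "((\<lambda>s. sqrt (potential s)) has_real_derivative
      inverse (e * c) / 2 * (e\<^sup>2 - e\<^sup>2 * e\<^sup>2 / 2)) (at s)"
    unfolding sq[symmetric]
  proof (rule DERIV_chain2[OF DERIV_real_sqrt])
    show "0 < potential s" using assms by (rule potential_pos)
    show "(potential has_real_derivative e\<^sup>2 - e\<^sup>2 * e\<^sup>2 / 2) (at s)"
      unfolding potential_def[abs_def] exp_s[symmetric]
      by (auto intro!: derivative_eq_intros)
  qed
  ultimately have "(phase has_real_derivative
      2 * (inverse c * (e / 4)) + inverse (e * c) / 2 * (e\<^sup>2 - e\<^sup>2 * e\<^sup>2 / 2)) (at s)"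
    unfolding phase_def[abs_def] by (intro DERIV_add DERIV_cmult)
  also have "2 * (inverse c * (e / 4)) + inverse (e * c) / 2 * (e\<^sup>2 - e\<^sup>2 * e\<^sup>2 / 2)
      = e * (1 - e\<^sup>2 / 4) / c"
    using e c(1) by (simp add: field_simps power2_eq_square)
  also have "\<dots> = e * c"
    unfolding c(2)[symmetric] using c(1) by (simp add: power2_eq_square)
  finally show ?thesis unfolding sq .
qed

lemma isCont_phase: "s < ln 4 \<Longrightarrow> isCont phase s"
  using phase_deriv DERIV_isCont by blast

text \<open>Here \<theta> is \<open>pi / 4\<close>. Divided by \<open>pi\<close>, the value is
  \<open>1 / 2 + 1 / pi\<close>, the limit of the index ratio.\<close>

lemma phase_ln_2: "phase (ln 2) = pi / 2 + 1"
proof -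
  have "arcsin (exp (ln 2 / 2) / 2) = arcsin (sin (pi / 4))"
    by (simp add: sin_45 exp_half_eq_sqrt)
  also have "\<dots> = pi / 4" by (intro arcsin_sin) auto
  finally show ?thesis by (simp add: phase_def potential_def)
qed

text \<open>With limit 0 at the left end, the total phase is \<open>pi\<close>, so the predicted
  number of zeros is \<open>N\<close>, within 1/2 of the true number \<open>n\<close>. Hence lower
  counts on the two sides of \<open>ln 2\<close> leave no room asymptotically.\<close>

lemma phase_ln_4: "phase (ln 4) = pi"
  by (simp add: phase_def potential_def exp_half_eq_sqrt power2_eq_square)

lemma phase_at_bot: "(phase \<longlongrightarrow> 0) at_bot"
proof -
  have e: "((\<lambda>s::real. exp (s / 2) / 2) \<longlongrightarrow> 0) at_bot"
  proof -
    have "((\<lambda>s::real. sqrt (exp s) / 2) \<longlongrightarrow> sqrt 0 / 2) at_bot"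
      by (intro tendsto_intros exp_at_bot) simp
    then show ?thesis by (simp add: exp_half_eq_sqrt)
  qed
  have "isCont arcsin 0" by (rule isCont_arcsin) auto
  from isCont_tendsto_compose[OF this e]
  have "((\<lambda>s. arcsin (exp (s / 2) / 2)) \<longlongrightarrow> 0) at_bot" by simp
  moreover have "((\<lambda>s. sqrt (potential s)) \<longlongrightarrow> sqrt (0 - 0\<^sup>2 / 4)) at_bot"
    unfolding potential_def by (intro tendsto_intros exp_at_bot) simp
  ultimately have "(phase \<longlongrightarrow> 2 * 0 + sqrt (0 - 0\<^sup>2 / 4)) at_bot"
    unfolding phase_def[abs_def] by (intro tendsto_add tendsto_mult tendsto_const)
  then show ?thesis by simp
qed

text \<open>Zeros are counted strictly below the turning point \<open>ln 4\<close>, so the full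
  phase is only approached; continuity up to that point suffices.\<close>

lemma phase_at_left_ln_4: "(phase \<longlongrightarrow> pi) (at_left (ln 4))"
proof -
  have "continuous_on {..ln 4} phase"
    unfolding phase_def[abs_def]
  proof (intro continuous_intros continuous_on_compose2[OF continuous_on_potential] ballI)
    fix s :: real assume s: "s \<in> {..ln 4}"
    have "exp (s / 2) \<le> exp (ln 4 / 2)" using s by simp
    also have "exp (ln 4 / 2) = (2::real)" by (simp add: exp_half_eq_sqrt)
    finally have "exp (s / 2) / 2 \<le> 1" by simp
    moreover have "0 < exp (s / 2) / 2" by simp
    ultimately show "- 1 \<le> exp (s / 2) / 2 \<and> exp (s / 2) / 2 \<le> 1" by linarith
  qed auto
  then have "(phase \<longlongrightarrow> phase (ln 4)) (at (ln 4) within {..ln 4})"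
    by (simp add: continuous_on_def)
  then show ?thesis
    unfolding phase_ln_4 by (rule tendsto_within_subset) auto
qed

section \<open>Asymptotic zero counts and short gaps\<close>

lemma eventually_nat_half_gt: "eventually (\<lambda>n. x < real n + 1/2) sequentially"
proof -
  obtain k where "x < real k" using reals_Archimedean2 by blast
  then show ?thesis by (intro eventually_sequentiallyI[of k]) simp
qed

text \<open>The interval is cut into pieces of phase increment \<open>C / N\<close> with
  \<open>C\<close> slightly above \<open>pi\<close>. Such a piece has length
  \<open>C / (N * r x)\<close> for some \<open>x\<close> in it, and the potential hardly varies over
  it, so Sturm puts a zero into each.\<close>

lemma eventually_card_log_zeros:
  assumes "A < B" "B < ln 4" and \<kappa>: "\<kappa> < (phase B - phase A) / pi"
  shows "eventually (\<lambda>n. \<kappa> * (real n + 1/2) \<le> card (log_zero n ` {1..n} \<inter> {A<..<B})) sequentially"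
proof -
  define D where "D = phase B - phase A"
  define r where "r s = sqrt (potential s)" for s
  have cont: "continuous_on {A..B} r" unfolding r_def[abs_def] by (intro continuous_intros)
  then obtain u where "u \<in> {A..B}" "\<And>s. s \<in> {A..B} \<Longrightarrow> r u \<le> r s"
    using continuous_attains_inf[of "{A..B}" r] \<open>A < B\<close> by auto
  moreover define m where "m = r u"
  moreover have "0 < r s" if "s \<in> {A..B}" for s
    unfolding r_def using potential_pos[of s] that assms by simp
  ultimately have m: "0 < m" "\<And>s. s \<in> {A..B} \<Longrightarrow> m \<le> r s" by auto
  have mvt: "\<exists>x>a. x < b \<and> phase b - phase a = (b - a) * r x" if "A \<le> a" "a < b" "b \<le> B" for a b
    using MVT2[of a b phase r] phase_deriv that assms(2) unfolding r_def by simp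
  have "0 < D"
    using mvt[of A B] m \<open>A < B\<close> unfolding D_def
    by (smt (verit) atLeastAtMost_iff mult_pos_pos)
  \<comment> \<open>Chosen so that \<open>C = pi + h\<close> still satisfies
    \<open>\<kappa> * C < D\<close>, whatever the sign of \<kappa>: the excess
    \<open>\<kappa> * h\<close> is at most half of \<open>D - \<kappa> * pi\<close>.\<close>
  define h where "h = (D - \<kappa> * pi) / (2 * (\<bar>\<kappa>\<bar> + 1))"
  define C where "C = pi + h"
  have gap: "0 < D - \<kappa> * pi" using \<kappa> by (simp add: D_def field_simps)
  then have "0 < h" by (simp add: h_def)
  then have "pi < C" "0 < C" unfolding C_def using pi_gt_zero by linarith+
  have "2 * ((\<bar>\<kappa>\<bar> + 1) * h) = D - \<kappa> * pi" by (simp add: h_def field_simps)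
  moreover have "\<kappa> * h \<le> (\<bar>\<kappa>\<bar> + 1) * h" using \<open>0 < h\<close> by (intro mult_right_mono) auto
  ultimately have "\<kappa> * C < D" using gap by (simp add: C_def algebra_simps)
  \<comment> \<open>The oscillation of \<open>r\<close> that a piece may have: as \<open>m\<close>
    is a lower bound of \<open>r\<close>, \<open>r x - \<eta>\<close> is at least
    \<open>r x * (pi / C)\<close>.\<close>
  define \<eta> where "\<eta> = m * (1 - pi / C)"
  have "0 < \<eta>" using m(1) \<open>pi < C\<close> \<open>0 < C\<close> by (simp add: \<eta>_def)
  have "uniformly_continuous_on {A..B} r"
    using cont by (intro compact_uniformly_continuous) auto
  then obtain \<delta> where \<delta>: "0 < \<delta>"
    "\<And>x y. x \<in> {A..B} \<Longrightarrow> y \<in> {A..B} \<Longrightarrow> dist y x < \<delta> \<Longrightarrow> dist (r y) (r x) < \<eta>"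
    using \<open>0 < \<eta>\<close> unfolding uniformly_continuous_on_def by metis
  \<comment> \<open>The first threshold makes every piece shorter than \<delta>; the second absorbs
    the loss of at most one piece to the floor.\<close>
  have bound: "\<kappa> * (real n + 1/2) \<le> card (log_zero n ` {1..n} \<inter> {A<..<B})"
    if n1: "C / (m * \<delta>) < real n + 1/2" and n2: "C / (D - \<kappa> * C) < real n + 1/2" for n
  proof -
    define N where "N = real n + 1/2"
    have "0 < N" by (simp add: N_def)
    have hit: "\<exists>z\<in>log_zero n ` {1..n}. a < z \<and> z < b"
      if ab: "A \<le> a" "a < b" "b \<le> B" "phase b - phase a = C / N" for a b
    proof -
      obtain x where x: "a < x" "x < b" "C / N = (b - a) * r x"
        using mvt[OF ab(1-3)] ab(4) by auto
      have "(b - a) * m \<le> C / N"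
        unfolding x(3) using m(2)[of x] x ab by (intro mult_left_mono) auto
      moreover have "C / N < m * \<delta>"
        using n1 m(1) \<delta>(1) \<open>0 < N\<close> by (simp add: N_def[symmetric] field_simps)
      ultimately have "b - a < \<delta>" using m(1) by (smt (verit) mult.commute mult_less_cancel_left_pos)
      have "(pi / (b - a))\<^sup>2 < N\<^sup>2 * potential y" if y: "a < y" "y < b" for y
      proof -
        have "dist y x < \<delta>" using x y \<open>b - a < \<delta>\<close> by (auto simp: dist_real_def)
        then have "dist (r y) (r x) < \<eta>" using \<delta>(2)[of x y] x y ab by simp
        then have "r x - \<eta> < r y" by (simp add: dist_real_def)
        moreover have "m * (1 - pi / C) \<le> r x * (1 - pi / C)"
          using m(2)[of x] x ab \<open>pi < C\<close> \<open>0 < C\<close> by (intro mult_right_mono) auto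
        ultimately have "r x * (pi / C) < r y" by (simp add: \<eta>_def algebra_simps)
        then have "N * (r x * (pi / C)) < N * r y"
          using \<open>0 < N\<close> by (rule mult_strict_left_mono)
        moreover have "N * (r x * (pi / C)) = pi / (b - a)"
        proof -
          have "C = N * r x * (b - a)" using x(3) \<open>0 < N\<close> by (simp add: field_simps)
          moreover have "0 < r x" using m(1) m(2)[of x] x ab by simp
          ultimately show ?thesis using \<open>0 < N\<close> \<open>a < b\<close> by simp
        qed
        ultimately have "(pi / (b - a))\<^sup>2 < (N * r y)\<^sup>2"
          using \<open>a < b\<close> by (intro power_strict_mono) auto
        then show ?thesis
          unfolding r_def using potential_pos[of y] y ab assms(2) by (simp add: power_mult_distrib)
      qed
      then show ?thesis
        using log_zero_between[OF \<open>a < b\<close>, of n] unfolding N_def by blast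
    qed
    define k where "k = nat \<lfloor>D * N / C\<rfloor>"
    have "0 \<le> D * N / C" using \<open>0 < D\<close> \<open>0 < N\<close> \<open>0 < C\<close> by simp
    then have k: "real k \<le> D * N / C" "D * N / C - 1 < real k"
      unfolding k_def by linarith+
    have "k \<le> card (log_zero n ` {1..n} \<inter> {A<..<B})"
    proof (rule card_ge_of_increments[where \<phi> = phase and c = "C / N"])
      show "continuous_on {A..B} phase"
        using assms(2) by (intro continuous_at_imp_continuous_on ballI isCont_phase) auto
      show "real k * (C / N) \<le> phase B - phase A"
        using k(1) \<open>0 < N\<close> \<open>0 < C\<close> unfolding D_def by (simp add: field_simps)
    qed (use \<open>A < B\<close> \<open>0 < N\<close> \<open>0 < C\<close> hit in auto)
    moreover have "\<kappa> * N \<le> D * N / C - 1"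
      using n2 \<open>\<kappa> * C < D\<close> \<open>0 < C\<close> by (simp add: N_def[symmetric] field_simps)
    ultimately show ?thesis using k(2) unfolding N_def by linarith
  qed
  show ?thesis
    using eventually_nat_half_gt eventually_nat_half_gt
    by (rule eventually_elim2) (rule bound)
qed

text \<open>The potential is 1 at \<open>ln 2\<close>, so near it every window of length
  \<open>L / N\<close> contains a zero. A window starting at \<open>ln 2\<close> yields a zero, and
  a window starting at that zero yields a second one less than \<open>L / N\<close> away.\<close>

lemma eventually_small_log_gap:
  assumes "pi < L"
  shows "eventually (\<lambda>n. \<exists>k\<in>{1..<n}. log_zero n (Suc k) - log_zero n k < L / (real n + 1/2)) sequentially"
proof -
  have "0 < L" using assms pi_gt_zero by linarith
  have "(pi / L)\<^sup>2 < 1" using assms \<open>0 < L\<close> by (simp add: abs_square_less_1)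
  moreover have "potential (ln 2) = 1" by (simp add: potential_eq)
  moreover have "isCont potential (ln 2)"
    using continuous_on_potential[of UNIV] by (simp add: continuous_on_eq_continuous_at)
  ultimately have "eventually (\<lambda>x. (pi / L)\<^sup>2 < potential x) (at (ln 2))"
    by (auto simp: isCont_def intro: order_tendstoD(1))
  then obtain \<delta> where \<delta>: "0 < \<delta>"
    "\<And>x. x \<noteq> ln 2 \<Longrightarrow> dist x (ln 2) < \<delta> \<Longrightarrow> (pi / L)\<^sup>2 < potential x"
    unfolding eventually_at by auto
  show ?thesis
    using eventually_nat_half_gt[of "2 * L / \<delta>"]
  proof eventually_elim
    fix n assume n: "2 * L / \<delta> < real n + 1/2"
    define N where "N = real n + 1/2"
    have "0 < N" by (simp add: N_def)
    \<comment> \<open>Two window lengths, since the second window starts up to \<open>L / N\<close>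
      beyond \<open>ln 2\<close>.\<close>
    have small: "2 * (L / N) < \<delta>"
      using n \<delta>(1) \<open>0 < N\<close> by (simp add: N_def[symmetric] field_simps)
    have hit: "\<exists>i\<in>{1..n}. a < log_zero n i \<and> log_zero n i < a + L / N"
      if a: "ln 2 \<le> a" "a < ln 2 + L / N" for a
    proof -
      have pot: "(pi / (a + L / N - a))\<^sup>2 < (real n + 1/2)\<^sup>2 * potential x"
        if x: "a < x" "x < a + L / N" for x
      proof -
        have "(pi / L)\<^sup>2 < potential x"
          using a x small by (intro \<delta>(2)) (auto simp: dist_real_def)
        then have "N\<^sup>2 * (pi / L)\<^sup>2 < N\<^sup>2 * potential x" using \<open>0 < N\<close> by simp
        then show ?thesis unfolding N_def
          by (simp add: power_divide power_mult_distrib mult.commute)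
      qed
      have "a < a + L / N" using \<open>0 < L\<close> \<open>0 < N\<close> by simp
      then show ?thesis by (rule log_zero_between[OF _ pot]) blast+
    qed
    obtain k where k: "k \<in> {1..n}" "ln 2 < log_zero n k" "log_zero n k < ln 2 + L / N"
      using hit[of "ln 2"] \<open>0 < L\<close> \<open>0 < N\<close> by auto
    obtain i where i: "i \<in> {1..n}" "log_zero n k < log_zero n i" "log_zero n i < log_zero n k + L / N"
      using hit[of "log_zero n k"] k by auto
    have "k < i"
      using i k strict_mono_on_less[OF strict_mono_on_log_zero] by simp
    then have "log_zero n (Suc k) \<le> log_zero n i"
      using i(1) k(1) by (intro strict_mono_on_leD[OF strict_mono_on_log_zero]) auto
    then show "\<exists>k\<in>{1..<n}. log_zero n (Suc k) - log_zero n k < L / (real n + 1/2)"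
      using i k \<open>k < i\<close> unfolding N_def by (intro bexI[of _ k]) auto
  qed
qed

section \<open>From counts to indices, and from relative to logarithmic gaps\<close>

text \<open>Turns a lower count of zeros to the left of the \<open>j\<close>-th one into a lower
  bound for \<open>j\<close>; the mirror image below yields an upper bound.\<close>

lemma card_log_zeros_below:
  assumes "j \<in> {1..n}" "B \<le> log_zero n j"
  shows "card (log_zero n ` {1..n} \<inter> {A<..<B}) \<le> j"
proof -
  have "log_zero n ` {1..n} \<inter> {A<..<B} \<subseteq> log_zero n ` {1..<j}"
  proof (clarsimp)
    fix i assume i: "Suc 0 \<le> i" "i \<le> n" "log_zero n i < B"
    then have "i < j"
      using assms strict_mono_on_less[OF strict_mono_on_log_zero, of i n j] by auto
    with i show "log_zero n i \<in> log_zero n ` {Suc 0..<j}" by simp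
  qed
  then have "card (log_zero n ` {1..n} \<inter> {A<..<B}) \<le> card (log_zero n ` {1..<j})"
    by (intro card_mono) auto
  also have "\<dots> \<le> card {1..<j}" by (rule card_image_le) simp
  finally show ?thesis by simp
qed

lemma card_log_zeros_above:
  assumes "j \<in> {1..n}" "log_zero n j \<le> A"
  shows "card (log_zero n ` {1..n} \<inter> {A<..<B}) \<le> n - j"
proof -
  have "log_zero n ` {1..n} \<inter> {A<..<B} \<subseteq> log_zero n ` {j<..n}"
  proof (clarsimp)
    fix i assume i: "Suc 0 \<le> i" "i \<le> n" "A < log_zero n i"
    then have "j < i"
      using assms strict_mono_on_less[OF strict_mono_on_log_zero, of j n i] by auto
    with i show "log_zero n i \<in> log_zero n ` {j<..n}" by simp
  qed
  then have "card (log_zero n ` {1..n} \<inter> {A<..<B}) \<le> card (log_zero n ` {j<..n})"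
    by (intro card_mono) auto
  also have "\<dots> \<le> card {j<..n}" by (rule card_image_le) simp
  finally show ?thesis by simp
qed

text \<open>The scale \<open>N\<close> cancels, and the quotient is the square of
  \<open>(b / a - a / b) / 2\<close> for the exponentials of the half logarithms.\<close>

lemma rel_gap_eq_sinh:
  assumes "j \<in> {1..<n}"
  shows "rel_gap n j = (sinh ((log_zero n (Suc j) - log_zero n j) / 2))\<^sup>2"
proof -
  define a b where "a = exp (log_zero n j / 2)" and "b = exp (log_zero n (Suc j) / 2)"
  define N where "N = real n + 1/2"
  have pos: "0 < a" "0 < b" "0 < N" by (simp_all add: a_def b_def N_def)
  have ex: "exp x = (exp (x / 2))\<^sup>2" for x :: real by (simp add: exp_double[symmetric])
  have x: "laguerre_zero n j = N * a\<^sup>2" "laguerre_zero n (j + 1) = N * b\<^sup>2"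
    using assms laguerre_zero_eq_exp[of j n] laguerre_zero_eq_exp[of "Suc j" n]
      ex[of "log_zero n j"] ex[of "log_zero n (Suc j)"]
    unfolding a_def b_def N_def by auto
  have "sinh ((log_zero n (Suc j) - log_zero n j) / 2) = (b / a - a / b) / 2"
    unfolding sinh_field_def a_def b_def
    by (simp add: diff_divide_distrib exp_diff)
  also have "\<dots>\<^sup>2 = (b\<^sup>2 - a\<^sup>2)\<^sup>2 / (4 * a\<^sup>2 * b\<^sup>2)"
    using pos by (simp add: field_simps power2_eq_square)
  also have "\<dots> = rel_gap n j"
    unfolding rel_gap_def x using pos by (simp add: field_simps power2_eq_square)
  finally show ?thesis ..
qed

section \<open>Minimal gaps\<close>

lemma Lim_transform_eventually_eq:
  "(f \<longlongrightarrow> l) F \<Longrightarrow> eventually (\<lambda>x. f x = g x) F \<Longrightarrow> l = l' \<Longrightarrow> (g \<longlongrightarrow> l') F"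
  using Lim_transform_eventually by blast

lemma tendsto_difference_quotient_0:
  fixes f :: "real \<Rightarrow> real"
  assumes "(f has_real_derivative D) (at 0)" "f 0 = 0" "d \<longlonglongrightarrow> 0" "\<And>n. n \<ge> 2 \<Longrightarrow> d n \<noteq> 0"
  shows "(\<lambda>n. f (d n) / d n) \<longlonglongrightarrow> D"
proof -
  have "((\<lambda>h. f h / h) \<longlongrightarrow> D) (at 0)"
    using assms(1,2) by (simp add: DERIV_def)
  moreover have "filterlim d (at 0) sequentially"
    unfolding filterlim_at using assms(3,4) by (auto intro: eventually_sequentiallyI[of 2])
  ultimately show ?thesis by (rule filterlim_compose)
qed

theorem theorem8p1:
  fixes j :: "nat \<Rightarrow> nat"
  assumes "\<And>n. n \<ge> 2 \<Longrightarrow> j n \<in> {1..<n} \<and> rel_gap n (j n) = min_rel_gap n"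
  shows "((\<lambda>n. (real n)\<^sup>2 * min_rel_gap n) \<longlonglongrightarrow> pi\<^sup>2 / 4)
    \<and> ((\<lambda>n. real n * min_log_gap n) \<longlonglongrightarrow> pi)
    \<and> ((\<lambda>n. laguerre_zero n (j n) / real n) \<longlonglongrightarrow> 2)
    \<and> ((\<lambda>n. laguerre_zero n (j n + 1) / real n) \<longlonglongrightarrow> 2)
    \<and> ((\<lambda>n. laguerre_zero n (j n + 1) - laguerre_zero n (j n)) \<longlonglongrightarrow> 2 * pi)
    \<and> ((\<lambda>n. real (j n) / real n) \<longlonglongrightarrow> 1 / 2 + 1 / pi)"
proof -
  have j: "j n \<in> {1..<n}" "j n \<in> {1..n}" "Suc (j n) \<in> {1..n}" if "n \<ge> 2" for n
    using assms[OF that] by auto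
  define N where "N n = real n + 1/2" for n
  define d where "d n = log_zero n (Suc (j n)) - log_zero n (j n)" for n
  have N_pos: "0 < N n" for n by (simp add: N_def)
  have d_pos: "0 < d n" if "n \<ge> 2" for n
    unfolding d_def using strict_mono_on_log_zero j[OF that] by (simp add: strict_mono_on_def)
  \<comment> \<open>Squared \<open>sinh\<close> is increasing on positive arguments, so a minimizer
    of the relative gap also minimizes the logarithmic gap.\<close>
  have d_least: "d n \<le> log_zero n (Suc k) - log_zero n k" if n: "n \<ge> 2" and k: "k \<in> {1..<n}" for n k
  proof -
    have "rel_gap n (j n) \<le> rel_gap n k"
      using assms[OF n] k unfolding min_rel_gap_def by simp
    then have le: "(sinh (d n / 2))\<^sup>2 \<le> (sinh ((log_zero n (Suc k) - log_zero n k) / 2))\<^sup>2"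
      using rel_gap_eq_sinh[OF j(1)[OF n]] rel_gap_eq_sinh[OF k] by (simp add: d_def)
    have "k \<in> {1..n}" "Suc k \<in> {1..n}" using k by auto
    then have "0 < log_zero n (Suc k) - log_zero n k"
      using strict_mono_on_log_zero by (simp add: strict_mono_on_def)
    then have "sinh (d n / 2) \<le> sinh ((log_zero n (Suc k) - log_zero n k) / 2)"
      by (intro power2_le_imp_le[OF le]) simp
    then show ?thesis by simp
  qed
  have min_log_gap: "min_log_gap n = d n" if n: "n \<ge> 2" for n
    unfolding min_log_gap_def
  proof (rule Min_eqI)
    show "d n \<in> (\<lambda>j. ln (laguerre_zero n (j + 1)) - ln (laguerre_zero n j)) ` {1..<n}"
      using j(1)[OF n] log_gap_eq[OF j(1)[OF n]] by (force simp: d_def)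
  qed (use d_least[OF n] log_gap_eq in auto)
  have min_rel_gap: "min_rel_gap n = (sinh (d n / 2))\<^sup>2" if n: "n \<ge> 2" for n
    using assms[OF n] rel_gap_eq_sinh[OF j(1)[OF n]] by (simp add: d_def)

  \<comment> \<open>The Sturm points of the minimal gaps are collected into a sequence; their limit
    will locate the gaps.\<close>
  have "\<exists>x. log_zero n (j n) < x \<and> x < log_zero n (Suc (j n)) \<and> (N n)\<^sup>2 * potential x = (pi / d n)\<^sup>2"
    if "n \<ge> 2" for n
    using adjacent_log_zeros[OF j(1)[OF that]] unfolding N_def d_def by blast
  then have "\<exists>x. \<forall>n\<ge>2. log_zero n (j n) < x n \<and> x n < log_zero n (Suc (j n))
      \<and> (N n)\<^sup>2 * potential (x n) = (pi / d n)\<^sup>2"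
    by (intro choice) blast
  then obtain x where "\<forall>n\<ge>2. log_zero n (j n) < x n \<and> x n < log_zero n (Suc (j n))
      \<and> (N n)\<^sup>2 * potential (x n) = (pi / d n)\<^sup>2" ..
  then have x: "log_zero n (j n) < x n" "x n < log_zero n (Suc (j n))"
    "(N n)\<^sup>2 * potential (x n) = (pi / d n)\<^sup>2" if "n \<ge> 2" for n
    using that by simp_all

  have N_ratio: "(\<lambda>n. N n / real n) \<longlonglongrightarrow> 1"
  proof -
    have "(\<lambda>n. 1 + 1/2 * (1 / real n)) \<longlonglongrightarrow> 1 + 1/2 * 0"
      by (intro tendsto_intros lim_1_over_n)
    moreover have "eventually (\<lambda>n. 1 + 1/2 * (1 / real n) = N n / real n) sequentially"
      by (rule eventually_sequentiallyI[of 1]) (simp add: N_def field_simps)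
    ultimately show ?thesis by (rule Lim_transform_eventually_eq) simp
  qed
  have N_ratio': "(\<lambda>n. real n / N n) \<longlonglongrightarrow> 1"
    using tendsto_inverse[OF N_ratio] by simp
  have N_inverse: "(\<lambda>n. 1 / N n) \<longlonglongrightarrow> 0"
  proof -
    have "(\<lambda>n. (real n / N n) * (1 / real n)) \<longlonglongrightarrow> 1 * 0"
      by (intro tendsto_mult N_ratio' lim_1_over_n)
    moreover have "eventually (\<lambda>n. (real n / N n) * (1 / real n) = 1 / N n) sequentially"
      by (rule eventually_sequentiallyI[of 1]) simp
    ultimately show ?thesis by (rule Lim_transform_eventually_eq) simp
  qed

  have Nd_ge: "pi \<le> N n * d n" if n: "n \<ge> 2" for n
  proof -
    have "(pi / d n)\<^sup>2 \<le> (N n)\<^sup>2 * 1"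
      unfolding x(3)[OF n, symmetric] by (intro mult_left_mono potential_le_1) simp
    then have "(pi / d n)\<^sup>2 \<le> (N n)\<^sup>2" by simp
    then have "pi / d n \<le> N n" using less_imp_le[OF N_pos] by (rule power2_le_imp_le)
    then show ?thesis using d_pos[OF n] by (simp add: field_simps)
  qed
  \<comment> \<open>Sturm bounds the minimal gap from below, and the short gap near
    \<open>ln 2\<close> bounds it from above.\<close>
  have Nd: "(\<lambda>n. N n * d n) \<longlonglongrightarrow> pi"
  proof (rule order_tendstoI)
    fix a assume "a < pi"
    then show "eventually (\<lambda>n. a < N n * d n) sequentially"
      using Nd_ge by (intro eventually_sequentiallyI[of 2]) force
  next
    fix L assume "pi < L"
    show "eventually (\<lambda>n. N n * d n < L) sequentially"
      using eventually_small_log_gap[OF \<open>pi < L\<close>] eventually_ge_at_top[of 2]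
    proof eventually_elim
      case (elim n)
      then obtain k where "k \<in> {1..<n}" "log_zero n (Suc k) - log_zero n k < L / N n"
        unfolding N_def by blast
      then have "d n < L / N n" using d_least[OF elim(2)] by force
      then show ?case using N_pos[of n] by (simp add: field_simps)
    qed
  qed
  have d: "d \<longlonglongrightarrow> 0"
  proof -
    have "(\<lambda>n. N n * d n * (1 / N n)) \<longlonglongrightarrow> pi * 0" by (intro tendsto_mult Nd N_inverse)
    then show ?thesis using N_pos by (simp add: less_imp_neq[symmetric])
  qed
  have nd: "(\<lambda>n. real n * d n) \<longlonglongrightarrow> pi"
  proof -
    have "(\<lambda>n. (real n / N n) * (N n * d n)) \<longlonglongrightarrow> 1 * pi" by (intro tendsto_mult Nd N_ratio')
    then show ?thesis using N_pos by (simp add: less_imp_neq[symmetric])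
  qed
  have lim1: "(\<lambda>n. (real n)\<^sup>2 * min_rel_gap n) \<longlonglongrightarrow> pi\<^sup>2 / 4"
  proof -
    have "(\<lambda>n. sinh (d n / 2) / (d n / 2)) \<longlonglongrightarrow> 1"
    proof (rule tendsto_difference_quotient_0)
      show "(sinh has_real_derivative 1) (at 0)"
        by (auto intro!: derivative_eq_intros)
      show "(\<lambda>n. d n / 2) \<longlonglongrightarrow> 0" using tendsto_divide[OF d tendsto_const[of 2]] by simp
    qed (use d_pos in force)+
    then have "(\<lambda>n. (real n * d n / 2 * (sinh (d n / 2) / (d n / 2)))\<^sup>2) \<longlonglongrightarrow> (pi / 2 * 1)\<^sup>2"
      by (intro tendsto_intros nd) auto
    moreover have "eventually (\<lambda>n. (real n * d n / 2 * (sinh (d n / 2) / (d n / 2)))\<^sup>2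
        = (real n)\<^sup>2 * min_rel_gap n) sequentially"
      using d_pos min_rel_gap
      by (intro eventually_sequentiallyI[of 2]) (force simp: power_mult_distrib power_divide)
    ultimately show ?thesis by (rule Lim_transform_eventually_eq) (simp add: power_divide)
  qed
  have lim2: "(\<lambda>n. real n * min_log_gap n) \<longlonglongrightarrow> pi"
    by (rule Lim_transform_eventually_eq[OF nd eventually_sequentiallyI[of 2]])
      (simp_all add: min_log_gap)

  \<comment> \<open>The potential at the Sturm point is \<open>(pi / (N * d))^2\<close>. Its limit 1
    is the maximum, attained only where \<open>exp s = 2\<close>, which forces
    \<open>exp (x n)\<close> to tend to 2.\<close>
  have potential_x: "(\<lambda>n. potential (x n)) \<longlonglongrightarrow> 1"
  proof -
    have "(\<lambda>n. (pi / (N n * d n))\<^sup>2) \<longlonglongrightarrow> (pi / pi)\<^sup>2"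
      by (intro tendsto_intros Nd) simp
    moreover have "eventually (\<lambda>n. (pi / (N n * d n))\<^sup>2 = potential (x n)) sequentially"
    proof (rule eventually_sequentiallyI[of 2])
      fix n :: nat assume "2 \<le> n"
      then show "(pi / (N n * d n))\<^sup>2 = potential (x n)"
        using x(3)[of n] d_pos[of n] N_pos[of n] by (simp add: field_simps power2_eq_square)
    qed
    ultimately show ?thesis by (rule Lim_transform_eventually_eq) simp
  qed
  have "(\<lambda>n. sqrt (1 - potential (x n))) \<longlonglongrightarrow> sqrt (1 - 1)"
    by (intro tendsto_intros potential_x)
  then have "(\<lambda>n. \<bar>1 - exp (x n) / 2\<bar>) \<longlonglongrightarrow> 0" by (simp add: potential_eq)
  then have "(\<lambda>n. 1 - exp (x n) / 2) \<longlonglongrightarrow> 0" by (rule tendsto_rabs_zero_cancel)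
  then have "(\<lambda>n. 2 * (1 - (1 - exp (x n) / 2))) \<longlonglongrightarrow> 2 * (1 - 0)" by (intro tendsto_intros)
  then have exp_x: "(\<lambda>n. exp (x n)) \<longlonglongrightarrow> 2" by simp
  \<comment> \<open>The Sturm point lies inside the gap, so the left zero is between
    \<open>x n - d n\<close> and \<open>x n\<close>.\<close>
  have exp_zero: "(\<lambda>n. exp (log_zero n (j n))) \<longlonglongrightarrow> 2"
  proof (rule tendsto_sandwich[of "\<lambda>n. exp (x n) * exp (- d n)"])
    have "(\<lambda>n. exp (x n) * exp (- d n)) \<longlonglongrightarrow> 2 * exp (- 0)"
      by (intro tendsto_intros exp_x d)
    then show "(\<lambda>n. exp (x n) * exp (- d n)) \<longlonglongrightarrow> 2" by simp
    show "eventually (\<lambda>n. exp (x n) * exp (- d n) \<le> exp (log_zero n (j n))) sequentially"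
      using x(2) by (intro eventually_sequentiallyI[of 2]) (force simp: exp_add[symmetric] d_def)
    show "eventually (\<lambda>n. exp (log_zero n (j n)) \<le> exp (x n)) sequentially"
      using x(1) by (intro eventually_sequentiallyI[of 2]) (force intro: less_imp_le)
  qed (rule exp_x)
  have zero: "(\<lambda>n. log_zero n (j n)) \<longlonglongrightarrow> ln 2"
    using tendsto_ln[OF exp_zero] by simp
  have exp_zero': "(\<lambda>n. exp (log_zero n (Suc (j n)))) \<longlonglongrightarrow> 2"
  proof -
    have "(\<lambda>n. exp (log_zero n (j n)) * exp (d n)) \<longlonglongrightarrow> 2 * exp 0"
      by (intro tendsto_intros exp_zero d)
    then show ?thesis by (simp add: d_def exp_add[symmetric])
  qed

  have lim3: "(\<lambda>n. laguerre_zero n (j n) / real n) \<longlonglongrightarrow> 2"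
  proof -
    have "(\<lambda>n. N n / real n * exp (log_zero n (j n))) \<longlonglongrightarrow> 1 * 2"
      by (intro tendsto_mult N_ratio exp_zero)
    moreover have "eventually (\<lambda>n. N n / real n * exp (log_zero n (j n))
        = laguerre_zero n (j n) / real n) sequentially"
      by (rule eventually_sequentiallyI[of 2]) (simp add: laguerre_zero_eq_exp[OF j(2)] N_def)
    ultimately show ?thesis by (rule Lim_transform_eventually_eq) simp
  qed
  have lim4: "(\<lambda>n. laguerre_zero n (j n + 1) / real n) \<longlonglongrightarrow> 2"
  proof -
    have "(\<lambda>n. N n / real n * exp (log_zero n (Suc (j n)))) \<longlonglongrightarrow> 1 * 2"
      by (intro tendsto_mult N_ratio exp_zero')
    moreover have "eventually (\<lambda>n. N n / real n * exp (log_zero n (Suc (j n)))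
        = laguerre_zero n (j n + 1) / real n) sequentially"
      by (rule eventually_sequentiallyI[of 2]) (simp add: laguerre_zero_eq_exp[OF j(3)] N_def)
    ultimately show ?thesis by (rule Lim_transform_eventually_eq) simp
  qed
  have lim5: "(\<lambda>n. laguerre_zero n (j n + 1) - laguerre_zero n (j n)) \<longlonglongrightarrow> 2 * pi"
  proof -
    have "(\<lambda>n. (exp (d n) - 1) / d n) \<longlonglongrightarrow> 1"
      by (rule tendsto_difference_quotient_0[OF _ _ d])
        (use d_pos in \<open>force intro!: derivative_eq_intros\<close>)+
    \<comment> \<open>The plain gap is \<open>N * exp z * (exp d - 1)\<close> with \<open>z\<close>
      the left logarithmic zero; inserting \<open>d / d\<close> splits it into three factors with
      known limits.\<close>
    then have "(\<lambda>n. exp (log_zero n (j n)) * (N n * d n) * ((exp (d n) - 1) / d n)) \<longlonglongrightarrow> 2 * pi * 1"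
      by (intro tendsto_mult exp_zero Nd)
    moreover have "eventually (\<lambda>n. exp (log_zero n (j n)) * (N n * d n) * ((exp (d n) - 1) / d n)
        = laguerre_zero n (j n + 1) - laguerre_zero n (j n)) sequentially"
    proof (rule eventually_sequentiallyI[of 2])
      fix n :: nat assume n: "2 \<le> n"
      have "exp (log_zero n (Suc (j n))) = exp (log_zero n (j n)) * exp (d n)"
        by (simp add: d_def exp_add[symmetric])
      then have "laguerre_zero n (j n + 1) - laguerre_zero n (j n)
          = exp (log_zero n (j n)) * N n * (exp (d n) - 1)"
        using laguerre_zero_eq_exp[OF j(2)[OF n]] laguerre_zero_eq_exp[OF j(3)[OF n]]
        by (simp add: N_def field_simps)
      then show "exp (log_zero n (j n)) * (N n * d n) * ((exp (d n) - 1) / d n)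
          = laguerre_zero n (j n + 1) - laguerre_zero n (j n)"
        using d_pos[OF n] by simp
    qed
    ultimately show ?thesis by (rule Lim_transform_eventually_eq) simp
  qed

  have below: "eventually (\<lambda>n. a < real (j n) / N n) sequentially" if a: "a < 1 / 2 + 1 / pi" for a
  proof -
    \<comment> \<open>The slack measured in phase. One third is spent on stopping at
      \<open>B\<close> short of \<open>ln 2\<close>, one third on starting at a finite
      \<open>A\<close>, and the last keeps the inequality strict.\<close>
    define e where "e = pi / 2 + 1 - a * pi"
    have "a * pi < (1 / 2 + 1 / pi) * pi" using a pi_gt_zero by (rule mult_strict_right_mono)
    moreover have "(1 / 2 + 1 / pi) * pi = pi / 2 + 1" by (simp add: distrib_right)
    ultimately have "0 < e" unfolding e_def by linarith
    have "(phase \<longlongrightarrow> pi / 2 + 1) (at_left (ln 2))"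
      using isCont_phase[of "ln 2"] unfolding phase_ln_2[symmetric] isCont_def
      by (auto intro: tendsto_within_subset)
    then have "eventually (\<lambda>s. pi / 2 + 1 - e / 3 < phase s \<and> s < ln 2) (at_left (ln 2))"
      using \<open>0 < e\<close> by (intro eventually_conj order_tendstoD(1)) (auto simp: eventually_at_filter)
    then obtain B where B: "pi / 2 + 1 - e / 3 < phase B" "B < ln 2"
      using eventually_happens'[OF trivial_limit_at_left_real] by blast
    have "eventually (\<lambda>s. phase s < e / 3 \<and> s < B) at_bot"
      using \<open>0 < e\<close> by (intro eventually_conj order_tendstoD(2)[OF phase_at_bot] eventually_gt_at_bot) auto
    then obtain A where A: "phase A < e / 3" "A < B"
      using eventually_happens'[OF trivial_limit_at_bot_linorder] by blast
    have "a * pi = pi / 2 + 1 - e" by (simp add: e_def)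
    then have "a * pi < phase B - phase A" using A(1) B(1) \<open>0 < e\<close> by linarith
    then have "a < (phase B - phase A) / pi" by (simp add: field_simps)
    then obtain \<kappa> where \<kappa>: "a < \<kappa>" "\<kappa> < (phase B - phase A) / pi" using dense by blast
    have "ln 2 < ln (4::real)" by simp
    with B(2) have "B < ln 4" by linarith
    show ?thesis
      \<comment> \<open>The left zero tends to \<open>ln 2\<close>, so it eventually exceeds
        \<open>B\<close> and the zeros counted all have smaller index.\<close>
      using eventually_card_log_zeros[OF A(2) \<open>B < ln 4\<close> \<kappa>(2)] order_tendstoD(1)[OF zero B(2)]
        eventually_ge_at_top[of 2]
    proof eventually_elim
      case (elim n)
      have "\<kappa> * N n \<le> real (j n)"
        using elim(1) card_log_zeros_below[OF j(2)[OF elim(3)], of B A] elim(2)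
        unfolding N_def by linarith
      moreover have "a * N n < \<kappa> * N n" using \<kappa>(1) N_pos by simp
      ultimately have "a * N n < real (j n)" by linarith
      then show ?case using N_pos[of n] by (simp add: field_simps)
    qed
  qed
  have above: "eventually (\<lambda>n. real (j n) / N n < b) sequentially" if b: "1 / 2 + 1 / pi < b" for b
  proof -
    \<comment> \<open>The same argument to the right of \<open>ln 2\<close>, where phase
      \<open>pi / 2 - 1\<close> remains: it bounds \<open>n - j n\<close> from below, hence
      \<open>j n\<close> from above because there are exactly \<open>n\<close> zeros.\<close>
    define e where "e = b * pi - (pi / 2 + 1)"
    have "(1 / 2 + 1 / pi) * pi < b * pi" using b pi_gt_zero by (rule mult_strict_right_mono)
    moreover have "(1 / 2 + 1 / pi) * pi = pi / 2 + 1" by (simp add: distrib_right)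
    ultimately have "0 < e" unfolding e_def by linarith
    have ln24: "ln 2 < ln (4::real)" by simp
    have "(phase \<longlongrightarrow> pi / 2 + 1) (at_right (ln 2))"
      using isCont_phase[of "ln 2"] unfolding phase_ln_2[symmetric] isCont_def
      by (auto intro: tendsto_within_subset)
    then have "eventually (\<lambda>s. phase s < pi / 2 + 1 + e / 3 \<and> s \<in> {ln 2<..<ln 4}) (at_right (ln 2))"
      using \<open>0 < e\<close> ln24
      by (intro eventually_conj order_tendstoD(2) eventually_at_right_real) auto
    then obtain A where A: "phase A < pi / 2 + 1 + e / 3" "ln 2 < A" "A < ln 4"
      using eventually_happens'[OF trivial_limit_at_right_real] by fastforce
    have "eventually (\<lambda>s. pi - e / 3 < phase s \<and> s \<in> {A<..<ln 4}) (at_left (ln 4))"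
      using \<open>0 < e\<close> A(3)
      by (intro eventually_conj order_tendstoD(1)[OF phase_at_left_ln_4] eventually_at_left_real) auto
    then obtain B where B: "pi - e / 3 < phase B" "A < B" "B < ln 4"
      using eventually_happens'[OF trivial_limit_at_left_real] by fastforce
    have "(1 - b) * pi = pi / 2 - 1 - e" by (simp add: e_def algebra_simps)
    then have "(1 - b) * pi < phase B - phase A" using A(1) B(1) \<open>0 < e\<close> by linarith
    then have "1 - b < (phase B - phase A) / pi" by (simp add: field_simps)
    then obtain \<kappa> where \<kappa>: "1 - b < \<kappa>" "\<kappa> < (phase B - phase A) / pi" using dense by blast
    show ?thesis
      using eventually_card_log_zeros[OF B(2,3) \<kappa>(2)] order_tendstoD(2)[OF zero A(2)]
        eventually_ge_at_top[of 2]
    proof eventually_elim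
      case (elim n)
      have "\<kappa> * N n \<le> real (n - j n)"
        using elim(1) card_log_zeros_above[OF j(2)[OF elim(3)], of A B] elim(2)
        unfolding N_def by linarith
      then have "\<kappa> * N n \<le> N n - real (j n)"
        using j(2)[OF elim(3)] by (simp add: of_nat_diff N_def)
      moreover have "(1 - b) * N n < \<kappa> * N n" using \<kappa>(1) N_pos by simp
      ultimately have "real (j n) < b * N n" by (simp add: algebra_simps)
      then show ?case using N_pos[of n] by (simp add: field_simps)
    qed
  qed
  have "(\<lambda>n. real (j n) / N n) \<longlonglongrightarrow> 1 / 2 + 1 / pi"
    using below above by (rule order_tendstoI)
  then have "(\<lambda>n. real (j n) / N n * (N n / real n)) \<longlonglongrightarrow> (1 / 2 + 1 / pi) * 1"
    by (intro tendsto_mult N_ratio)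
  then have lim6: "(\<lambda>n. real (j n) / real n) \<longlonglongrightarrow> 1 / 2 + 1 / pi"
    using N_pos by (simp add: less_imp_neq[symmetric])
  show ?thesis using lim1 lim2 lim3 lim4 lim5 lim6 by blast
qed

end
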